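(* Let $L\ge1$, $\epsilon,M>0$, $n\in\mathbb{N}$, let $\mathscr{E}_L$ be a sandwichable family of subsets of $[0,1]^n$, and let $h\in L^\infty(\mathbb{R}^n)$ with $\|h\|_\infty\le M$. Let $$\mathscr{G}=\left\{Q\in\mathcal{D}(\mathbb{R}^n):\ \left|\frac1{\mathscr{L}(E)}\int_Eh\,d\mathscr{L}-\frac1{\mathscr{L}(Q)}\int_Qh\,d\mathscr{L}\right|\le\epsilon\ \text{ for all }E\in\mathscr{E}_L(Q)\right\}.$$ Then $\mathscr{B}=\mathcal{D}(\mathbb{R}^n)\setminus\mathscr{G}$ is $C$-Carleson with a constant $C=C(M,n,\epsilon,\mathscr{E}_L)$; that is, for every $R\in\mathcal{D}(\mathbb{R}^n)$, $$\sum_{Q\in\mathscr{B},\ Q\subseteq R}\ell(Q)^n\le C\,\ell(R)^n .$$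
   Context: $\mathscr{L}$ is Lebesgue measure on $\mathbb{R}^n$; $\mathcal{D}(\mathbb{R}^n)$ is the family of dyadic cubes and $\ell(Q)$ is the side length of $Q$. Sandwichable family: a family $\mathscr{E}_L$ of Lebesgue measurable subsets of $[0,1]^n$, with $\mathscr{L}(E)\ge c$ for all $E\in\mathscr{E}_L$ for some constant $c=c(L,n)>0$, is sandwichable if every sequence $E_j\in\mathscr{E}_L$ has a subsequence $E_{j_k}$ for which there are families of measurable sets $\{L_\epsilon\}_{0<\epsilon<1/2}$ and $\{U_\epsilon\}_{0<\epsilon<1/2}$ such that: (a) for every $0<\epsilon<1/2$ there is $k_0>0$ with $L_\epsilon\subseteq E_{j_k}\subseteq U_\epsilon$ for all $k\ge k_0$; (b) for $\epsilon'<\epsilon$, $L_\epsilon\subseteq L_{\epsilon'}$ and $U_{\epsilon'}\subseteq U_\epsilon$; (c) $\mathscr{L}(L_\epsilon)/\mathscr{L}(U_\epsilon)\ge1-\epsilon$. For $Q\in\mathcal{D}(\mathbb{R}^n)$, $T_Q$ is the affine map (translation composed with dilation by $\ell(Q)$) sending $[0,1]^n$ onto $Q$ (up to boundary), and $\mathscr{E}_L(Q)=\{T_Q(E):E\in\mathscr{E}_L\}$. *)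

theory Defs
  imports "HOL-Analysis.Analysis" "HOL-Probability.Essential_Supremum"
begin

definition half_open_cube :: "real ^ 'n \<Rightarrow> real \<Rightarrow> (real ^ 'n) set" where
  "half_open_cube a l = {x. \<forall>i. a $ i \<le> x $ i \<and> x $ i < a $ i + l}"

(* All scales 2^k, k an integer, are included; cubes are half-open, so that those of a fixed
   scale partition the space. *)
definition dyadic_cubes :: "(real ^ 'n) set set" where
  "dyadic_cubes = {half_open_cube (\<chi> i. real_of_int (m i) * 2 powi k) (2 powi k) |m (k::int). True}"

(* A cube is represented by its set of points; side length and corner are recovered from this set.
   Both descriptions are unique on half-open cubes of positive side length, see
   side_length_half_open_cube and corner_half_open_cube below. *)
definition side_length :: "(real ^ 'n) set \<Rightarrow> real" where
  "side_length Q = (THE l. 0 < l \<and> (\<exists>a. Q = half_open_cube a l))"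

definition corner :: "(real ^ 'n) set \<Rightarrow> real ^ 'n" where
  "corner Q = (THE a. \<exists>l>0. Q = half_open_cube a l)"

definition cube_map :: "(real ^ 'n) set \<Rightarrow> real ^ 'n \<Rightarrow> real ^ 'n" where
  "cube_map Q x = corner Q + side_length Q *\<^sub>R x"

definition transported_family :: "(real ^ 'n) set set \<Rightarrow> (real ^ 'n) set \<Rightarrow> (real ^ 'n) set set" where
  "transported_family \<E> Q = (\<lambda>E. cube_map Q ` E) ` \<E>"

(* cbox 0 1 is the closed unit cube. In the ratio condition U e cannot have infinite measure:
   measure would then be 0 and the ratio 0, which is below 1 - e. *)
definition sandwichable :: "(real ^ 'n) set set \<Rightarrow> bool" where
  "sandwichable \<E> \<longleftrightarrow>
     (\<forall>E\<in>\<E>. E \<in> sets lebesgue \<and> E \<subseteq> cbox 0 1) \<and>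
     (\<exists>c>0. \<forall>E\<in>\<E>. c \<le> measure lebesgue E) \<and>
     (\<forall>E :: nat \<Rightarrow> (real ^ 'n) set. (\<forall>j. E j \<in> \<E>) \<longrightarrow>
        (\<exists>(r :: nat \<Rightarrow> nat) (L :: real \<Rightarrow> (real ^ 'n) set) (U :: real \<Rightarrow> (real ^ 'n) set).
           strict_mono r \<and>
           (\<forall>e\<in>{0<..<1/2}. L e \<in> sets lebesgue \<and> U e \<in> sets lebesgue) \<and>
           (\<forall>e\<in>{0<..<1/2}. \<exists>k0>0. \<forall>k\<ge>k0. L e \<subseteq> E (r k) \<and> E (r k) \<subseteq> U e) \<and>
           (\<forall>e\<in>{0<..<1/2}. \<forall>e'\<in>{0<..<1/2}. e' < e \<longrightarrow> L e \<subseteq> L e' \<and> U e' \<subseteq> U e) \<and>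
           (\<forall>e\<in>{0<..<1/2}. 1 - e \<le> measure lebesgue (L e) / measure lebesgue (U e))))"

definition Linfty_norm :: "(real ^ 'n \<Rightarrow> real) \<Rightarrow> ereal" where
  "Linfty_norm h = esssup lebesgue (\<lambda>x. ereal \<bar>h x\<bar>)"

definition average :: "(real ^ 'n \<Rightarrow> real) \<Rightarrow> (real ^ 'n) set \<Rightarrow> real" where
  "average h E = 1 / measure lebesgue E * (LINT x:E|lebesgue. h x)"

definition good_cubes ::
    "real \<Rightarrow> (real ^ 'n) set set \<Rightarrow> (real ^ 'n \<Rightarrow> real) \<Rightarrow> (real ^ 'n) set set" where
  "good_cubes \<epsilon> \<E> h =
     {Q \<in> dyadic_cubes. \<forall>E \<in> transported_family \<E> Q. \<bar>average h E - average h Q\<bar> \<le> \<epsilon>}"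

(* The sum is taken in ennreal, where it always exists, so the inequality includes convergence. *)
definition carleson :: "real \<Rightarrow> (real ^ 'n) set set \<Rightarrow> bool" where
  "carleson C \<B> \<longleftrightarrow>
     (\<forall>R\<in>dyadic_cubes.
        (\<Sum>\<^sub>\<infinity>Q\<in>{Q\<in>\<B>. Q \<subseteq> R}. ennreal (side_length Q ^ CARD('n)))
          \<le> ennreal (C * side_length R ^ CARD('n)))"

lemma half_open_cube_subset:
  fixes a b :: "real ^ 'n"
  assumes "half_open_cube a l \<subseteq> half_open_cube b s" "0 < l"
  shows "b $ i \<le> a $ i \<and> a $ i + l \<le> b $ i + s"
proof
  have "a \<in> half_open_cube a l"
    using assms(2) by (simp add: half_open_cube_def)
  then have "a \<in> half_open_cube b s" using assms(1) by blast
  then show "b $ i \<le> a $ i" by (simp add: half_open_cube_def)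
  show "a $ i + l \<le> b $ i + s"
  proof (rule dense_le)
    fix y assume y: "y < a $ i + l"
    define t where "t = max 0 (y - a $ i)"
    have t: "0 \<le> t" "t < l" "y \<le> a $ i + t"
      using y assms(2) by (auto simp: t_def)
    have "(\<chi> j. a $ j + t) \<in> half_open_cube a l"
      using t by (simp add: half_open_cube_def)
    then have "(\<chi> j. a $ j + t) \<in> half_open_cube b s" using assms(1) by blast
    then have "a $ i + t < b $ i + s" by (simp add: half_open_cube_def)
    then show "y \<le> b $ i + s" using t by linarith
  qed
qed

lemma half_open_cube_inject:
  fixes a b :: "real ^ 'n"
  assumes "half_open_cube a l = half_open_cube b s" "0 < l" "0 < s"
  shows "a = b" "l = s"
proof -
  have *: "a $ i = b $ i \<and> a $ i + l = b $ i + s" for i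
    using half_open_cube_subset[of a l b s i] half_open_cube_subset[of b s a l i] assms
    by auto
  then show "a = b" by (simp add: vec_eq_iff)
  show "l = s" using *[of undefined] by linarith
qed

lemma side_length_half_open_cube: "0 < l \<Longrightarrow> side_length (half_open_cube a l) = l"
  unfolding side_length_def by (rule the_equality) (auto dest: half_open_cube_inject)

lemma corner_half_open_cube: "0 < l \<Longrightarrow> corner (half_open_cube a l) = a"
  unfolding corner_def by (rule the_equality) (auto dest: half_open_cube_inject)

end

theory Submission
  imports Defs
begin

text \<open>
  The averages of a bounded function over dyadic cubes cannot change much from one generation to
  a later one on too many cubes, because the resulting increments are orthogonal in \<open>L\<^sup>2\<close>. Bad cubes
  are reduced to this principle as follows.

  The sandwich condition makes the family precompact for the pseudometric
  \<open>measure lebesgue (sym_diff E E')\<close>. Since every measurable subset of the unit cube is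
  approximated by unions of dyadic cells, there is a single number \<open>N\<close> of generations such that all
  sets of the family are approximated, with the same error, by unions of cells of side \<open>2\<^sup>-\<^sup>N\<close>
  (\<open>sandwichable_uniform_approximation\<close>).

  Let \<open>Q\<close> be bad, witnessed by the set \<open>E\<close>. As \<open>h\<close> is bounded and the measure of \<open>E\<close> is bounded
  below, \<open>E\<close> may be replaced by its approximating union of cells. Hence the averages \<open>h\<^sub>P\<close> over
  the cells \<open>P\<close> of \<open>Q\<close> that are \<open>N\<close> generations down differ from the average \<open>h\<^sub>Q\<close> in the mean, and
  the variance \<open>\<Sum>P. (h\<^sub>P - h\<^sub>Q)\<^sup>2 |P|\<close> is at least a fixed multiple of \<open>|Q|\<close>
  (\<open>bad_cube_variance\<close>); here \<open>|P|\<close> is the measure of \<open>P\<close>.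

  This variance equals \<open>\<Sum>P. h\<^sub>P\<^sup>2 |P| - h\<^sub>Q\<^sup>2 |Q|\<close>. Summed over all cubes of all generations below
  \<open>R\<close> it telescopes, with step \<open>N\<close>, to at most \<open>N M\<^sup>2 |R|\<close> (\<open>cell_variance_packing\<close>).
  Comparing the two estimates gives the packing condition.
\<close>

section \<open>The dyadic grid\<close>

text \<open>
  The dyadic cube of side \<open>2 powi k\<close> that contains a given point. Describing cubes by equality of
  integer parts makes the partition and nesting properties into arithmetic of \<open>\<lfloor>_\<rfloor>\<close> and \<open>div\<close>.
\<close>

definition cube_at :: "int \<Rightarrow> real ^ 'n \<Rightarrow> (real ^ 'n) set" where
  "cube_at k x = {y. \<forall>i. \<lfloor>y $ i / 2 powi k\<rfloor> = \<lfloor>x $ i / 2 powi k\<rfloor>}"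

definition dyadic_level :: "int \<Rightarrow> (real ^ 'n) set set" where
  "dyadic_level k = range (cube_at k)"

definition cells :: "int \<Rightarrow> (real ^ 'n) set \<Rightarrow> (real ^ 'n) set set" where
  "cells k S = {P \<in> dyadic_level k. P \<subseteq> S}"

lemma mem_cube_at_self: "x \<in> cube_at k x"
  by (simp add: cube_at_def)

lemma cube_at_eq: "y \<in> cube_at k x \<Longrightarrow> cube_at k x = cube_at k y"
  by (auto simp: cube_at_def)

lemma dyadic_level_eq_cube_at: "Q \<in> dyadic_level k \<Longrightarrow> x \<in> Q \<Longrightarrow> Q = cube_at k x"
  unfolding dyadic_level_def using cube_at_eq by blast

lemma cube_at_in_level: "cube_at k x \<in> dyadic_level k"
  by (simp add: dyadic_level_def)

lemma half_open_cube_eq_floor: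
  "half_open_cube (\<chi> i. real_of_int (m i) * 2 powi k) (2 powi k)
     = {x :: real ^ 'n. \<forall>i. \<lfloor>x $ i / 2 powi k\<rfloor> = m i}"
proof -
  have p: "(0::real) < 2 powi k" by simp
  have "real_of_int z * 2 powi k \<le> t \<and> t < real_of_int z * 2 powi k + 2 powi k
      \<longleftrightarrow> \<lfloor>t / 2 powi k\<rfloor> = z" for t and z :: int
    using p by (simp add: floor_eq_iff pos_le_divide_eq pos_divide_less_eq distrib_right)
  then show ?thesis by (simp add: half_open_cube_def)
qed

lemma cube_at_half_open:
  "cube_at k x = half_open_cube (\<chi> i. real_of_int \<lfloor>x $ i / 2 powi k\<rfloor> * 2 powi k) (2 powi k)"
  unfolding half_open_cube_eq_floor cube_at_def ..

lemma half_open_cube_in_level: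
  "half_open_cube (\<chi> i. real_of_int (m i) * 2 powi k) (2 powi k) \<in> dyadic_level k"
proof -
  have "half_open_cube (\<chi> i. real_of_int (m i) * 2 powi k) (2 powi k)
      = cube_at k (\<chi> i. real_of_int (m i) * 2 powi k)"
    unfolding half_open_cube_eq_floor cube_at_def by simp
  then show ?thesis by (simp add: cube_at_in_level)
qed

lemma dyadic_levelE:
  assumes "Q \<in> dyadic_level k"
  obtains m where "Q = half_open_cube (\<chi> i. real_of_int (m i) * 2 powi k) (2 powi k)"
  using assms by (auto simp: dyadic_level_def cube_at_half_open)

lemma dyadic_cubes_eq_levels: "dyadic_cubes = (\<Union>k. dyadic_level k)"
proof (intro equalityI subsetI)
  fix Q :: "(real ^ 'n) set"
  assume "Q \<in> dyadic_cubes"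
  then show "Q \<in> (\<Union>k. dyadic_level k)"
    unfolding dyadic_cubes_def using half_open_cube_in_level by blast
next
  fix Q :: "(real ^ 'n) set"
  assume "Q \<in> (\<Union>k. dyadic_level k)"
  then show "Q \<in> dyadic_cubes"
    unfolding dyadic_cubes_def by clarify (metis dyadic_levelE)
qed

lemma side_length_level: "Q \<in> dyadic_level k \<Longrightarrow> side_length Q = 2 powi k"
  by (auto elim!: dyadic_levelE simp: side_length_half_open_cube)

lemma half_open_unit_cube: "half_open_cube 0 1 \<in> dyadic_level 0"
  using half_open_cube_in_level[of "\<lambda>_. 0" 0] by (simp add: zero_vec_def)

text \<open>
  Dividing further by a power of two before taking the integer part depends only on the integer
  part taken before: dyadic cubes are nested.
\<close>

lemma cube_at_antimono:
  assumes "k' \<le> k"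
  shows "cube_at k' x \<subseteq> cube_at k x"
proof -
  obtain j where j: "k = k' + int j" using assms by (metis zle_iff_zadd)
  have "\<lfloor>t / 2 powi k\<rfloor> = \<lfloor>t / 2 powi k'\<rfloor> div 2 ^ j" for t :: real
  proof -
    have "(2::real) powi k = 2 powi k' * real_of_int (2 ^ j)"
      by (simp add: j power_int_add)
    then have "t / 2 powi k = t / 2 powi k' / real_of_int (2 ^ j)"
      by (simp only: divide_divide_eq_left)
    then show ?thesis using floor_divide_real_eq_div[of "2 ^ j" "t / 2 powi k'"] by (simp only:) simp
  qed
  then show ?thesis by (auto simp: cube_at_def)
qed

lemma level_nested:
  assumes "P \<in> dyadic_level k'" "Q \<in> dyadic_level k" "k' \<le> k" "x \<in> P" "x \<in> Q"
  shows "P \<subseteq> Q"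
  using assms cube_at_antimono dyadic_level_eq_cube_at by metis

lemma level_disjoint:
  assumes "P \<in> dyadic_level k" "Q \<in> dyadic_level k" "P \<noteq> Q"
  shows "P \<inter> Q = {}"
  using assms dyadic_level_eq_cube_at by (metis disjoint_iff)

lemma level_nonempty: "P \<in> dyadic_level k \<Longrightarrow> P \<noteq> {}"
  using mem_cube_at_self by (auto simp: dyadic_level_def)

lemma half_open_cube_measure:
  fixes a :: "real ^ 'n"
  assumes "0 < l"
  shows "half_open_cube a l \<in> lmeasurable" "measure lebesgue (half_open_cube a l) = l ^ CARD('n)"
    "negligible (cbox a (\<chi> i. a $ i + l) - half_open_cube a l)"
proof -
  define b where "b = (\<chi> i. a $ i + l)"
  \<comment> \<open>The half-open cube lies between the open and the closed box, which differ by a null set.\<close>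
  define N where "N = cbox a b - half_open_cube a l"
  have "box a b \<subseteq> half_open_cube a l" and sub: "half_open_cube a l \<subseteq> cbox a b"
    by (auto simp: half_open_cube_def b_def mem_box_cart less_imp_le)
  then have N: "negligible N"
    unfolding N_def by (intro negligible_subset[OF negligible_frontier_interval[of a b]]) auto
  have eq: "half_open_cube a l = cbox a b - N" using sub by (auto simp: N_def)
  show "half_open_cube a l \<in> lmeasurable"
    unfolding eq using N by (intro fmeasurable_Diff) (auto dest: negligible_imp_measurable fmeasurableD)
  have "measure lebesgue (cbox a b - N) = measure lebesgue (cbox a b)"
    using N by (intro measure_Diff_null_set) (auto simp: negligible_iff_null_sets)
  also have "\<dots> = l ^ CARD('n)"
    using assms by (simp add: b_def content_cbox_if_cart interval_eq_empty_cart not_less)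
  finally show "measure lebesgue (half_open_cube a l) = l ^ CARD('n)" by (simp only: eq)
  show "negligible (cbox a (\<chi> i. a $ i + l) - half_open_cube a l)"
    using N by (simp add: N_def b_def)
qed

lemma level_measure:
  fixes Q :: "(real ^ 'n) set"
  assumes "Q \<in> dyadic_level k"
  shows "Q \<in> lmeasurable" "measure lebesgue Q = (2 powi k) ^ CARD('n)" "0 < measure lebesgue Q"
proof -
  show "Q \<in> lmeasurable" and m: "measure lebesgue Q = (2 powi k) ^ CARD('n)"
    using assms by (auto elim!: dyadic_levelE simp: half_open_cube_measure)
  then show "0 < measure lebesgue Q" by simp
qed

text \<open>
  A cell is determined by the integer parts of the scaled coordinates of any of its points, and for
  points of a bounded set these range over a finite set.
\<close>

lemma finite_cells:
  fixes S :: "(real ^ 'n) set"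
  assumes "bounded S"
  shows "finite (cells k S)"
proof -
  obtain B where B: "\<And>x i. x \<in> S \<Longrightarrow> \<bar>x $ i\<bar> \<le> B"
    using assms unfolding bounded_iff by (meson component_le_norm_cart order_trans)
  define lo where "lo = \<lfloor>- B / 2 powi k\<rfloor>"
  define hi where "hi = \<lfloor>B / 2 powi k\<rfloor>"
  define C where "C m = {x :: real ^ 'n. \<forall>i. \<lfloor>x $ i / 2 powi k\<rfloor> = m i}" for m
  have "cells k S \<subseteq> C ` (UNIV \<rightarrow>\<^sub>E {lo..hi})"
  proof
    fix P assume P: "P \<in> cells k S"
    then obtain x where x: "x \<in> P" using level_nonempty unfolding cells_def by blast
    then have "P = C (\<lambda>i. \<lfloor>x $ i / 2 powi k\<rfloor>)"
      using P dyadic_level_eq_cube_at[of P k x] by (auto simp: cells_def C_def cube_at_def)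
    moreover have "\<lfloor>x $ i / 2 powi k\<rfloor> \<in> {lo..hi}" for i
    proof -
      have "- B \<le> x $ i" "x $ i \<le> B" using B[of x i] x P by (auto simp: cells_def)
      then have "- B / 2 powi k \<le> x $ i / 2 powi k" "x $ i / 2 powi k \<le> B / 2 powi k"
        by (intro divide_right_mono; simp)+
      then show ?thesis
        unfolding lo_def hi_def by (meson atLeastAtMost_iff floor_mono)
    qed
    ultimately show "P \<in> C ` (UNIV \<rightarrow>\<^sub>E {lo..hi})" by (auto simp: PiE_UNIV_domain)
  qed
  then show ?thesis by (rule finite_subset) (intro finite_imageI finite_PiE, auto)
qed

lemma bounded_level: "Q \<in> dyadic_level k \<Longrightarrow> bounded Q"
proof -
  assume "Q \<in> dyadic_level k"
  then obtain a l where "Q = half_open_cube a l" by (auto elim: dyadic_levelE)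
  then have "Q \<subseteq> cbox a (\<chi> i. a $ i + l)"
    by (auto simp: half_open_cube_def mem_box_cart less_imp_le)
  then show "bounded Q" using bounded_cbox bounded_subset by blast
qed

lemma Union_cells:
  assumes "R \<in> dyadic_level k" "k' \<le> k"
  shows "\<Union>(cells k' R) = R"
proof (intro equalityI subsetI)
  fix x assume "x \<in> R"
  then have "cube_at k' x \<subseteq> R"
    using cube_at_antimono[OF assms(2)] dyadic_level_eq_cube_at[OF assms(1)] by metis
  then show "x \<in> \<Union>(cells k' R)"
    using cube_at_in_level mem_cube_at_self unfolding cells_def by blast
qed (auto simp: cells_def)

lemma disjoint_family_cells: "\<C> \<subseteq> cells k S \<Longrightarrow> disjoint_family_on (\<lambda>P. P) \<C>"
  using level_disjoint unfolding disjoint_family_on_def cells_def by blast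

lemma cells_cells:
  assumes "R \<in> dyadic_level k" "k' \<le> k" "k'' \<le> k'"
  shows "cells k'' R = (\<Union>Q\<in>cells k' R. cells k'' Q)"
proof (intro equalityI subsetI)
  fix P assume P: "P \<in> cells k'' R"
  then obtain x where x: "x \<in> P" using level_nonempty unfolding cells_def by blast
  then have "x \<in> \<Union>(cells k' R)" using P Union_cells[OF assms(1,2)] by (auto simp: cells_def)
  then obtain Q where "Q \<in> cells k' R" "x \<in> Q" by auto
  then show "P \<in> (\<Union>Q\<in>cells k' R. cells k'' Q)"
    using P x level_nested[of P k'' Q k' x] assms(3) by (auto simp: cells_def)
qed (auto simp: cells_def)

text \<open>
  The generations of cells below a dyadic cube form a tree; this regrouping of sums is what makes
  the variances of the cubes of one level telescope.
\<close>

lemma sum_cells_cells: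
  assumes "R \<in> dyadic_level k" "k' \<le> k" "k'' \<le> k'"
  shows "(\<Sum>P\<in>cells k'' R. f P) = (\<Sum>Q\<in>cells k' R. \<Sum>P\<in>cells k'' Q. f P)"
proof -
  have "cells k'' Q \<inter> cells k'' Q' = {}" if "Q \<in> cells k' R" "Q' \<in> cells k' R" "Q \<noteq> Q'" for Q Q'
  proof -
    have "Q \<inter> Q' = {}" using that level_disjoint by (auto simp: cells_def)
    then show ?thesis using level_nonempty by (fastforce simp: cells_def)
  qed
  moreover have "finite (cells k'' Q)" if "Q \<in> cells k' R" for Q
    using that bounded_level finite_cells by (auto simp: cells_def)
  moreover have "finite (cells k' R)" using bounded_level finite_cells assms(1) by blast
  ultimately show ?thesis
    unfolding cells_cells[OF assms] by (intro sum.UNION_disjoint) auto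
qed

text \<open>
  The affine map of \<open>Q\<close> carries the dyadic grid to the dyadic grid, so that a step approximation
  of a set in the unit cube becomes one, with equally many generations, inside every dyadic cube.
\<close>

lemma cube_map_level:
  assumes "Q \<in> dyadic_level k" "P \<in> cells (- int N) (half_open_cube 0 1)"
  shows "cube_map Q ` P \<in> cells (k - int N) Q"
proof -
  have p: "(0::real) < 2 powi k" by simp
  obtain M where Q: "Q = half_open_cube (\<chi> i. real_of_int (M i) * 2 powi k) (2 powi k)"
    using assms(1) by (rule dyadic_levelE)
  have co: "corner Q = (\<chi> i. real_of_int (M i) * 2 powi k)" and s: "side_length Q = 2 powi k"
    unfolding Q using corner_half_open_cube side_length_half_open_cube p by blast+
  have "P \<in> dyadic_level (- int N)" and P01: "P \<subseteq> half_open_cube 0 1"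
    using assms(2) by (auto simp: cells_def)
  then obtain m where P: "P = half_open_cube (\<chi> i. real_of_int (m i) * 2 powi (- int N)) (2 powi (- int N))"
    by (auto elim: dyadic_levelE)
  have img: "cube_map Q ` half_open_cube a l = half_open_cube (corner Q + 2 powi k *\<^sub>R a) (2 powi k * l)" for a l
  proof (intro equalityI subsetI)
    fix x assume "x \<in> cube_map Q ` half_open_cube a l"
    then show "x \<in> half_open_cube (corner Q + 2 powi k *\<^sub>R a) (2 powi k * l)"
      using p by (auto simp: half_open_cube_def cube_map_def s distrib_left[symmetric])
  next
    fix x assume x: "x \<in> half_open_cube (corner Q + 2 powi k *\<^sub>R a) (2 powi k * l)"
    define y where "y = (1 / 2 powi k) *\<^sub>R (x - corner Q)"
    have "x = cube_map Q y" using p by (simp add: y_def cube_map_def s)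
    moreover have "y \<in> half_open_cube a l"
      using x p by (auto simp: half_open_cube_def y_def field_simps)
    ultimately show "x \<in> cube_map Q ` half_open_cube a l" by blast
  qed
  have e: "(2::real) powi (k - int N) = 2 powi k * 2 powi (- int N)"
    by (simp add: power_int_diff power_int_minus divide_inverse)
  have "cube_map Q ` P = half_open_cube (\<chi> i. real_of_int (m i + M i * 2 ^ N) * 2 powi (k - int N)) (2 powi (k - int N))"
    unfolding P img co by (rule arg_cong2[where f=half_open_cube])
      (simp_all add: vec_eq_iff e distrib_right power_int_minus field_simps)
  then have "cube_map Q ` P \<in> dyadic_level (k - int N)"
    using half_open_cube_in_level[of "\<lambda>i. m i + M i * 2 ^ N" "k - int N"] by simp
  moreover have "cube_map Q ` P \<subseteq> Q"
  proof -
    have "cube_map Q ` half_open_cube 0 1 = Q" unfolding img using co Q by simp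
    then show ?thesis using P01 by blast
  qed
  ultimately show ?thesis by (simp add: cells_def)
qed

section \<open>Approximation of sets by dyadic cells\<close>

lemma cube_at_dist:
  fixes x :: "real ^ 'n"
  assumes "y \<in> cube_at k x"
  shows "dist y x \<le> real CARD('n) * 2 powi k"
proof -
  have p: "(0::real) < 2 powi k" by simp
  have "\<bar>y $ i - x $ i\<bar> \<le> 2 powi k" for i
  proof -
    have "\<lfloor>y $ i / 2 powi k\<rfloor> = \<lfloor>x $ i / 2 powi k\<rfloor>" using assms by (simp add: cube_at_def)
    then have "\<bar>y $ i / 2 powi k - x $ i / 2 powi k\<bar> \<le> 1" by linarith
    then have "\<bar>y $ i - x $ i\<bar> / 2 powi k \<le> 1"
      by (simp add: diff_divide_distrib[symmetric])
    then show ?thesis using p by (simp add: divide_le_eq)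
  qed
  then have "(\<Sum>i\<in>UNIV. \<bar>(y - x) $ i\<bar>) \<le> real CARD('n) * 2 powi k"
    using sum_bounded_above[of UNIV "\<lambda>i. \<bar>(y - x) $ i\<bar>" "2 powi k"] by simp
  then show ?thesis using norm_le_l1_cart[of "y - x"] by (simp add: dist_norm)
qed

lemma lmeasurable_Union_cells:
  assumes "bounded S" "\<C> \<subseteq> cells k S"
  shows "\<Union>\<C> \<in> lmeasurable"
proof (rule fmeasurable.finite_Union)
  show "finite \<C>" using assms finite_cells finite_subset by blast
  show "\<C> \<subseteq> lmeasurable" using assms level_measure(1) by (auto simp: cells_def)
qed

text \<open>
  The cells of generation \<open>N\<close> inside \<open>U \<inter> Q\<close> have unions that increase with \<open>N\<close>, by nesting, and that
  exhaust \<open>U \<inter> Q\<close>, because the diameters of the cells around a point tend to zero.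
\<close>

lemma open_cell_exhaustion:
  fixes U :: "(real ^ 'n) set"
  assumes "open U" "Q \<in> dyadic_level 0"
  shows "(\<lambda>N. measure lebesgue (\<Union>(cells (- int N) (U \<inter> Q)))) \<longlonglongrightarrow> measure lebesgue (U \<inter> Q)"
proof -
  define A where "A N = \<Union>(cells (- int N) (U \<inter> Q))" for N
  have bd: "bounded (U \<inter> Q)" using bounded_level[OF assms(2)] by auto
  have meas: "A N \<in> lmeasurable" for N
    unfolding A_def using lmeasurable_Union_cells[OF bd] by blast
  have inc: "incseq A"
  proof (rule incseq_SucI)
    fix N
    show "A N \<subseteq> A (Suc N)"
    proof
      fix x assume "x \<in> A N"
      then obtain P where P: "P \<in> dyadic_level (- int N)" "P \<subseteq> U \<inter> Q" "x \<in> P"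
        by (auto simp: A_def cells_def)
      have "cube_at (- int (Suc N)) x \<subseteq> cube_at (- int N) x" by (rule cube_at_antimono) simp
      also have "\<dots> = P" using dyadic_level_eq_cube_at[OF P(1,3)] by simp
      finally show "x \<in> A (Suc N)"
        unfolding A_def cells_def using P(2) cube_at_in_level mem_cube_at_self by blast
    qed
  qed
  have un: "(\<Union>N. A N) = U \<inter> Q"
  proof (intro equalityI subsetI)
    fix x assume x: "x \<in> U \<inter> Q"
    then obtain e where e: "0 < e" "ball x e \<subseteq> U" using assms(1) open_contains_ball by blast
    have "(\<lambda>N. real CARD('n) * (1 / 2) ^ N) \<longlonglongrightarrow> real CARD('n) * 0"
      by (intro tendsto_mult_left LIMSEQ_power_zero) auto
    then have "\<forall>\<^sub>F N in sequentially. real CARD('n) * (1 / 2) ^ N < e"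
      by (rule order_tendstoD) (use e in simp)
    then obtain N where N: "real CARD('n) * (1 / 2) ^ N < e" by (auto simp: eventually_sequentially)
    have "cube_at (- int N) x \<subseteq> ball x e"
    proof
      fix y assume "y \<in> cube_at (- int N) x"
      then have "dist y x \<le> real CARD('n) * 2 powi (- int N)" by (rule cube_at_dist)
      then show "y \<in> ball x e"
        using N by (simp add: dist_commute power_int_minus power_one_over inverse_eq_divide)
    qed
    moreover have "cube_at (- int N) x \<subseteq> Q"
      using cube_at_antimono[of "- int N" 0 x] dyadic_level_eq_cube_at[OF assms(2), of x] x by auto
    ultimately have "cube_at (- int N) x \<in> cells (- int N) (U \<inter> Q)"
      using e cube_at_in_level by (auto simp: cells_def)
    then show "x \<in> (\<Union>N. A N)" using mem_cube_at_self unfolding A_def by blast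
  qed (auto simp: A_def cells_def)
  have "U \<inter> Q \<in> lmeasurable"
    using bd assms(1) level_measure(1)[OF assms(2)]
    by (intro bounded_set_imp_lmeasurable sets.Int) auto
  then have "(\<lambda>N. measure lebesgue (A N)) \<longlonglongrightarrow> measure lebesgue (\<Union>N. A N)"
    using meas inc un by (intro Lim_measure_incseq) (auto simp: fmeasurable_def less_top)
  then show ?thesis unfolding un by (simp add: A_def)
qed

text \<open>
  A measurable set is enclosed tightly in an open set, by outer regularity, and the open set is
  exhausted by cells. The part of \<open>E\<close> outside the half-open cube is null.
\<close>

lemma cell_approximation:
  fixes E :: "(real ^ 'n) set"
  assumes E: "E \<in> sets lebesgue" "E \<subseteq> cbox 0 1" and d: "0 < d"
  shows "\<forall>\<^sub>F N in sequentially. \<exists>\<C> \<subseteq> cells (- int N) (half_open_cube 0 1).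
           measure lebesgue (sym_diff E (\<Union>\<C>)) < d"
proof -
  define I :: "(real ^ 'n) set" where "I = half_open_cube 0 1"
  have I: "I \<in> dyadic_level 0" unfolding I_def by (rule half_open_unit_cube)
  have Im: "I \<in> lmeasurable" using level_measure(1)[OF I] .
  have Em: "E \<in> lmeasurable" using E bounded_cbox bounded_subset bounded_set_imp_lmeasurable by blast
  have negl: "negligible (E - I)"
    using half_open_cube_measure(3)[of 1 "0 :: real ^ 'n"] E(2)
    by (auto simp: I_def one_vec_def intro: negligible_subset)
  have EI: "E \<inter> I \<in> sets lebesgue" using E(1) Im by auto
  obtain U where U: "open U" "E \<inter> I \<subseteq> U" "U - E \<inter> I \<in> lmeasurable"
      "emeasure lebesgue (U - E \<inter> I) < ennreal (d / 2)"
    by (rule sets_lebesgue_outer_open[OF EI, of "d / 2"]) (use d in auto)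
  have Ud: "measure lebesgue (U - E \<inter> I) < d / 2"
    using U(3,4) d by (simp add: emeasure_eq_measure2 ennreal_less_iff)
  have UIm: "U \<inter> I \<in> lmeasurable"
    using bounded_level[OF I] U(1) Im by (intro bounded_set_imp_lmeasurable sets.Int) auto
  have "\<forall>\<^sub>F N in sequentially.
      measure lebesgue (\<Union>(cells (- int N) (U \<inter> I))) > measure lebesgue (U \<inter> I) - d / 2"
    using open_cell_exhaustion[OF U(1) I] d by (intro order_tendstoD) auto
  then show ?thesis
  proof (rule eventually_mono)
    fix N
    let ?\<C> = "cells (- int N) (U \<inter> I)"
    define F where "F = \<Union>?\<C>"
    assume "measure lebesgue (\<Union>?\<C>) > measure lebesgue (U \<inter> I) - d / 2"
    then have F: "measure lebesgue F > measure lebesgue (U \<inter> I) - d / 2" by (simp add: F_def)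
    have Fm: "F \<in> lmeasurable"
      unfolding F_def using bounded_level[OF I] by (intro lmeasurable_Union_cells[of "U \<inter> I"]) auto
    have FU: "F \<subseteq> U \<inter> I" by (auto simp: F_def cells_def)
    have "sym_diff E F \<subseteq> (E - I) \<union> ((U - E \<inter> I) \<union> (U \<inter> I - F))" using FU U(2) by auto
    then have "measure lebesgue (sym_diff E F) \<le> measure lebesgue ((E - I) \<union> ((U - E \<inter> I) \<union> (U \<inter> I - F)))"
      using Em Fm U(3) UIm Im by (intro measure_mono_fmeasurable) auto
    also have "\<dots> \<le> measure lebesgue (E - I) + (measure lebesgue (U - E \<inter> I) + measure lebesgue (U \<inter> I - F))"
      using Em Fm U(3) UIm Im
      by (intro order_trans[OF measure_Un_le] add_left_mono measure_Un_le) auto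
    also have "measure lebesgue (U \<inter> I - F) = measure lebesgue (U \<inter> I) - measure lebesgue F"
      using FU Fm UIm by (intro measurable_measure_Diff) auto
    also have "measure lebesgue (E - I) = 0" using negl by (rule negligible_imp_measure0)
    finally have "measure lebesgue (sym_diff E F) < d" using F Ud by linarith
    moreover have "?\<C> \<subseteq> cells (- int N) (half_open_cube 0 1)" by (auto simp: cells_def I_def)
    ultimately show "\<exists>\<C> \<subseteq> cells (- int N) (half_open_cube 0 1). measure lebesgue (sym_diff E (\<Union>\<C>)) < d"
      unfolding F_def by blast
  qed
qed

lemma measure_sym_diff_triangle:
  assumes "A \<in> fmeasurable M" "B \<in> fmeasurable M" "C \<in> fmeasurable M"
  shows "measure M (sym_diff A C) \<le> measure M (sym_diff A B) + measure M (sym_diff B C)"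
proof -
  have "measure M (sym_diff A C) \<le> measure M (sym_diff A B \<union> sym_diff B C)"
    using assms by (intro measure_mono_fmeasurable) auto
  also have "\<dots> \<le> measure M (sym_diff A B) + measure M (sym_diff B C)"
    using assms by (intro measure_Un_le) auto
  finally show ?thesis .
qed

text \<open>
  Both sets lie between \<open>L\<close> and \<open>U\<close>, so they differ at most on \<open>U - L\<close>, whose measure is at most
  \<open>e\<close> times that of \<open>U\<close>; and \<open>e < 1 / 2\<close> makes \<open>measure M U\<close> at most \<open>2 * measure M A\<close>. The ratio
  condition itself forces \<open>U\<close> to have finite measure, since \<open>measure\<close> is zero otherwise.
\<close>

lemma sandwich_sym_diff:
  assumes "A \<in> sets M" "B \<in> sets M" "L \<in> sets M" "U \<in> sets M"
    and "L \<subseteq> A" "A \<subseteq> U" "L \<subseteq> B" "B \<subseteq> U"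
    and e: "0 < e" "e < 1 / 2" and ratio: "1 - e \<le> measure M L / measure M U"
  shows "measure M (sym_diff A B) \<le> 2 * e * measure M A"
proof -
  have "measure M U \<noteq> 0" using ratio e by auto
  then have Upos: "0 < measure M U" using measure_nonneg[of M U] by linarith
  then have Um: "U \<in> fmeasurable M"
    using assms(4) by (metis fmeasurableI infinity_ennreal_def measure_eq_0_null_sets measure_zero_top top.not_eq_extremum order_less_irrefl)
  have Lm: "L \<in> fmeasurable M" and Am: "A \<in> fmeasurable M" and Bm: "B \<in> fmeasurable M"
    using assms fmeasurableI2[OF Um] by blast+
  have LU: "(1 - e) * measure M U \<le> measure M L" using ratio Upos by (simp add: pos_le_divide_eq)
  have LA: "measure M L \<le> measure M A" using assms Am by (intro measure_mono_fmeasurable) auto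
  have "(1 / 2) * measure M U \<le> (1 - e) * measure M U"
    using e Upos by (intro mult_right_mono) auto
  then have U2: "measure M U \<le> 2 * measure M A" using LU LA by linarith
  have "measure M (sym_diff A B) \<le> measure M (U - L)"
    using assms Um Lm Am Bm by (intro measure_mono_fmeasurable) auto
  also have "\<dots> = measure M U - measure M L"
    using assms Um Lm by (intro measurable_measure_Diff) auto
  also have "\<dots> \<le> e * measure M U" using LU by (simp add: left_diff_distrib)
  also have "\<dots> \<le> e * (2 * measure M A)" using U2 e by (intro mult_left_mono) auto
  finally show ?thesis by simp
qed

text \<open>
  This is the compactness behind the theorem. If no \<open>N\<close> worked, there would be for each \<open>N\<close> a set
  \<open>E N\<close> of the family that unions of cells of generation \<open>N\<close> do not approximate. By sandwiching,
  the sets of a subsequence are eventually close to one fixed set \<open>G\<close>, and \<open>G\<close> is approximated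
  by cells of every sufficiently late generation; hence so are the late sets of the subsequence.
\<close>

lemma sandwichable_uniform_approximation:
  fixes \<E> :: "(real ^ 'n) set set"
  assumes sw: "sandwichable \<E>" and d: "0 < d"
  shows "\<exists>N. \<forall>E\<in>\<E>. \<exists>\<C> \<subseteq> cells (- int N) (half_open_cube 0 1).
           measure lebesgue (sym_diff E (\<Union>\<C>)) < d"
proof (rule ccontr)
  define approx where "approx N r E \<longleftrightarrow>
    (\<exists>\<C> \<subseteq> cells (- int N) (half_open_cube 0 1). measure lebesgue (sym_diff E (\<Union>\<C>)) < r)"
    for N r and E :: "(real ^ 'n) set"
  assume "\<not> ?thesis"
  then have "\<forall>N. \<exists>E\<in>\<E>. \<not> approx N d E" by (simp add: approx_def)
  then obtain E where E: "\<And>N. E N \<in> \<E>" and bad: "\<And>N. \<not> approx N d (E N)" by metis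
  have Es: "E N \<in> sets lebesgue" "E N \<subseteq> cbox 0 1" for N
    using E[of N] sw[unfolded sandwichable_def, THEN conjunct1] by blast+
  have Em: "E N \<in> lmeasurable" for N
    by (rule bounded_set_imp_lmeasurable[OF bounded_subset[OF bounded_cbox Es(2)] Es(1)])
  have E1: "measure lebesgue (E N) \<le> 1" for N
  proof -
    have "measure lebesgue (E N) \<le> measure lebesgue (cbox 0 1 :: (real ^ 'n) set)"
      using Es by (intro measure_mono_fmeasurable) auto
    also have "\<dots> = 1" by (simp add: content_cbox_if_cart interval_eq_empty_cart)
    finally show ?thesis .
  qed
  \<comment> \<open>Subsets of the unit cube sandwiched at level \<open>e\<close> then differ by at most \<open>2 * e \<le> d / 2\<close>.\<close>
  define e where "e = min (d / 4) (1 / 3)"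
  have e: "0 < e" "e < 1 / 2" "2 * e \<le> d / 2" using d by (auto simp: e_def)
  have eI: "e \<in> {0<..<1/2}" using e by simp
  have "\<forall>j. E j \<in> \<E>" using E by blast
  then have "\<exists>(r :: nat \<Rightarrow> nat) (L :: real \<Rightarrow> (real ^ 'n) set) (U :: real \<Rightarrow> (real ^ 'n) set).
           strict_mono r \<and>
           (\<forall>e\<in>{0<..<1/2}. L e \<in> sets lebesgue \<and> U e \<in> sets lebesgue) \<and>
           (\<forall>e\<in>{0<..<1/2}. \<exists>k0>0. \<forall>k\<ge>k0. L e \<subseteq> E (r k) \<and> E (r k) \<subseteq> U e) \<and>
           (\<forall>e\<in>{0<..<1/2}. \<forall>e'\<in>{0<..<1/2}. e' < e \<longrightarrow> L e \<subseteq> L e' \<and> U e' \<subseteq> U e) \<and>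
           (\<forall>e\<in>{0<..<1/2}. 1 - e \<le> measure lebesgue (L e) / measure lebesgue (U e))"
    by (rule sw[unfolded sandwichable_def, THEN conjunct2, THEN conjunct2, THEN spec, of E, THEN mp])
  then obtain r L U where r: "strict_mono (r :: nat \<Rightarrow> nat)"
    and meas': "\<forall>e\<in>{0<..<1/2}. L e \<in> sets lebesgue \<and> (U e :: (real ^ 'n) set) \<in> sets lebesgue"
    and sand': "\<forall>e\<in>{0<..<1/2}. \<exists>k0>0. \<forall>k\<ge>k0. L e \<subseteq> E (r k) \<and> E (r k) \<subseteq> U e"
    and ratio': "\<forall>e\<in>{0<..<1/2}. 1 - e \<le> measure lebesgue (L e) / measure lebesgue (U e)"
    by (elim exE conjE)
  note meas = bspec[OF meas' eI] and ratio = bspec[OF ratio' eI]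
  obtain k0 where k0: "\<And>k. k \<ge> k0 \<Longrightarrow> L e \<subseteq> E (r k) \<and> E (r k) \<subseteq> U e" using bspec[OF sand' eI] by blast
  define G where "G = E (r k0)"
  obtain N1 where N1: "\<And>N. N \<ge> N1 \<Longrightarrow> approx N (d / 2) G"
    using cell_approximation[OF Es, of "d / 2" "r k0"] d
    unfolding eventually_sequentially approx_def G_def by auto
  define k where "k = max k0 N1"
  have "r k \<ge> N1" using seq_suble[OF r, of k] by (simp add: k_def)
  then obtain \<C> where \<C>: "\<C> \<subseteq> cells (- int (r k)) (half_open_cube 0 1)"
      "measure lebesgue (sym_diff G (\<Union>\<C>)) < d / 2"
    using N1 unfolding approx_def by blast
  have "measure lebesgue (sym_diff (E (r k)) G) \<le> 2 * e * measure lebesgue (E (r k))"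
    unfolding G_def using k0[of k] k0[of k0] meas e ratio Es
    by (intro sandwich_sym_diff[where L = "L e" and U = "U e"]) (auto simp: k_def)
  also have "\<dots> \<le> 2 * e * 1" using E1 e by (intro mult_left_mono) auto
  finally have "measure lebesgue (sym_diff (E (r k)) G) \<le> d / 2" using e by linarith
  moreover have "\<Union>\<C> \<in> lmeasurable"
    using \<C>(1) bounded_level[OF half_open_unit_cube] by (intro lmeasurable_Union_cells) auto
  then have "measure lebesgue (sym_diff (E (r k)) (\<Union>\<C>))
      \<le> measure lebesgue (sym_diff (E (r k)) G) + measure lebesgue (sym_diff G (\<Union>\<C>))"
    using Em by (intro measure_sym_diff_triangle) (auto simp: G_def)
  ultimately have "approx (r k) d (E (r k))" unfolding approx_def using \<C> by (intro exI[of _ \<C>]) auto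
  then show False using bad by blast
qed

section \<open>Set integrals and averages of bounded functions\<close>

lemma Linfty_norm_AE:
  assumes "Linfty_norm h \<le> ereal M"
  shows "AE x in lebesgue. \<bar>h x\<bar> \<le> M"
  using esssup_AE[where M = lebesgue and f = "\<lambda>x. ereal \<bar>h x\<bar>"] assms
  unfolding Linfty_norm_def by (auto elim!: eventually_mono dest: order_trans)

lemma bounded_set_integral:
  fixes g :: "'a \<Rightarrow> real"
  assumes "g \<in> borel_measurable \<mu>" "AE x in \<mu>. \<bar>g x\<bar> \<le> B" "S \<in> fmeasurable \<mu>"
  shows "set_integrable \<mu> S g" "\<bar>LINT x:S|\<mu>. g x\<bar> \<le> B * measure \<mu> S"
proof -
  have fin: "S \<in> sets \<mu>" "emeasure \<mu> S < \<infinity>" using assms(3) by (auto simp: fmeasurable_def)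
  show int: "set_integrable \<mu> S g"
    unfolding set_integrable_def
    by (rule integrableI_bounded_set_indicator[OF fin(1) assms(1) fin(2), of B]) (use assms(2) in auto)
  have intB: "integrable \<mu> (\<lambda>x. B * indicator S x)" using fin by simp
  have "\<bar>LINT x:S|\<mu>. g x\<bar> \<le> (LINT x|\<mu>. \<bar>indicator S x *\<^sub>R g x\<bar>)"
    unfolding set_lebesgue_integral_def by (rule integral_abs_bound)
  also have "\<dots> \<le> (LINT x|\<mu>. B * indicator S x)"
  proof (rule integral_mono_AE)
    show "integrable \<mu> (\<lambda>x. \<bar>indicator S x *\<^sub>R g x\<bar>)"
      using int unfolding set_integrable_def by (rule integrable_abs)
    show "AE x in \<mu>. \<bar>indicator S x *\<^sub>R g x\<bar> \<le> B * indicator S x"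
      using assms(2) by eventually_elim (auto simp: indicator_def)
  qed (rule intB)
  also have "\<dots> = B * measure \<mu> S" using fin by simp
  finally show "\<bar>LINT x:S|\<mu>. g x\<bar> \<le> B * measure \<mu> S" .
qed

text \<open>
  The integrals over the common part cancel.
\<close>

lemma set_integral_diff_le_sym_diff:
  fixes g :: "'a \<Rightarrow> real"
  assumes g: "g \<in> borel_measurable \<mu>" "AE x in \<mu>. \<bar>g x\<bar> \<le> B"
    and A: "A \<in> fmeasurable \<mu>" and B: "A' \<in> fmeasurable \<mu>"
  shows "\<bar>(LINT x:A|\<mu>. g x) - (LINT x:A'|\<mu>. g x)\<bar> \<le> B * measure \<mu> (sym_diff A A')"
proof -
  note bd = bounded_set_integral[OF g]
  have split: "(LINT x:X|\<mu>. g x) = (LINT x:X \<inter> Y|\<mu>. g x) + (LINT x:X - Y|\<mu>. g x)"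
    if "X \<in> fmeasurable \<mu>" "Y \<in> fmeasurable \<mu>" for X Y
    using that set_integral_Un[of "X \<inter> Y" "X - Y" \<mu> g] bd(1)[of "X \<inter> Y"] bd(1)[of "X - Y"]
    by (auto simp: Int_Diff_Un)
  have "(LINT x:A|\<mu>. g x) - (LINT x:A'|\<mu>. g x)
      = (LINT x:A - A'|\<mu>. g x) - (LINT x:A' - A|\<mu>. g x)"
    using split[OF A B] split[OF B A] by (simp add: Int_commute)
  also have "\<bar>\<dots>\<bar> \<le> B * measure \<mu> (A - A') + B * measure \<mu> (A' - A)"
    using bd(2)[of "A - A'"] bd(2)[of "A' - A"] A B by (auto intro!: order_trans[OF abs_triangle_ineq4] add_mono)
  also have "\<dots> = B * measure \<mu> (sym_diff A A')"
  proof -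
    have "(A - A') \<inter> (A' - A) = {}" by auto
    moreover have "A - A' \<in> fmeasurable \<mu>" "A' - A \<in> fmeasurable \<mu>" using A B by auto
    ultimately have "measure \<mu> (sym_diff A A') = measure \<mu> (A - A') + measure \<mu> (A' - A)"
      using measure_Un3[of "A - A'" \<mu> "A' - A"] by (simp only: measure_empty diff_0_right)
    then show ?thesis by (simp only: distrib_left)
  qed
  finally show ?thesis .
qed

lemma measure_Union_cells:
  assumes S: "bounded S" "\<C> \<subseteq> cells k S"
  shows "measure lebesgue (\<Union>\<C>) = (\<Sum>P\<in>\<C>. measure lebesgue P)"
proof -
  have fin: "finite \<C>" using S finite_cells finite_subset by blast
  have m: "P \<in> sets lebesgue" "emeasure lebesgue P \<noteq> \<infinity>" if "P \<in> \<C>" for P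
    using that S(2) level_measure(1)[of P k]
    by (auto simp: cells_def fmeasurable_def simp del: emeasure_completion)
  have "measure lebesgue (\<Union>P\<in>\<C>. P) = (\<Sum>P\<in>\<C>. measure lebesgue P)"
    by (rule measure_finite_Union[OF fin _ disjoint_family_cells[OF S(2)]]) (use m in auto)
  then show ?thesis by simp
qed

lemma set_integral_Union_cells:
  fixes h :: "real ^ 'n \<Rightarrow> real"
  assumes h: "h \<in> borel_measurable lebesgue" "AE x in lebesgue. \<bar>h x\<bar> \<le> M"
    and S: "bounded S" "\<C> \<subseteq> cells k S"
  shows "(LINT x:\<Union>\<C>|lebesgue. h x) = (\<Sum>P\<in>\<C>. LINT x:P|lebesgue. h x)"
proof -
  have fin: "finite \<C>" using S finite_cells finite_subset by blast
  have m: "P \<in> lmeasurable" if "P \<in> \<C>" for P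
    using that S(2) level_measure(1) by (auto simp: cells_def)
  show ?thesis
    using set_integral_finite_Union[OF fin disjoint_family_cells[OF S(2)], of lebesgue h]
      bounded_set_integral(1)[OF h] m by auto
qed

lemma average_times_measure:
  "Q \<in> dyadic_level k \<Longrightarrow> average h Q * measure lebesgue Q = (LINT x:Q|lebesgue. h x)"
  using level_measure(3)[of Q k] by (simp add: average_def)

lemma average_bound:
  assumes h: "h \<in> borel_measurable lebesgue" "AE x in lebesgue. \<bar>h x\<bar> \<le> M"
    and Q: "Q \<in> dyadic_level k"
  shows "\<bar>average h Q\<bar> \<le> M"
proof -
  have "\<bar>average h Q\<bar> * measure lebesgue Q = \<bar>average h Q * measure lebesgue Q\<bar>"
    by (simp add: abs_mult)
  also have "\<dots> = \<bar>LINT x:Q|lebesgue. h x\<bar>" using average_times_measure[OF Q] by simp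
  also have "\<dots> \<le> M * measure lebesgue Q"
    using bounded_set_integral(2)[OF h level_measure(1)[OF Q]] .
  finally show ?thesis using level_measure(3)[OF Q] by simp
qed

section \<open>Energy and variance on dyadic cells\<close>

text \<open>
  The squared \<open>L\<^sup>2\<close> norm over \<open>R\<close> of the conditional expectation of \<open>h\<close> on the cells of level \<open>k\<close>.
\<close>

definition energy :: "(real ^ 'n \<Rightarrow> real) \<Rightarrow> int \<Rightarrow> (real ^ 'n) set \<Rightarrow> real" where
  "energy h k R = (\<Sum>P\<in>cells k R. (average h P)\<^sup>2 * measure lebesgue P)"

text \<open>
  The squared \<open>L\<^sup>2\<close> norm over \<open>Q\<close> of the difference between the conditional expectation of \<open>h\<close> on
  the cells of level \<open>k\<close> and the average of \<open>h\<close> on \<open>Q\<close>.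
\<close>

definition cell_variance :: "(real ^ 'n \<Rightarrow> real) \<Rightarrow> int \<Rightarrow> (real ^ 'n) set \<Rightarrow> real" where
  "cell_variance h k Q = (\<Sum>P\<in>cells k Q. (average h P - average h Q)\<^sup>2 * measure lebesgue P)"

lemma cell_variance_nonneg: "0 \<le> cell_variance h k Q"
  unfolding cell_variance_def by (intro sum_nonneg) simp

text \<open>
  The Pythagorean identity: variance is second moment minus squared mean, because the averages on
  the cells have mean \<open>average h Q\<close>.
\<close>

lemma cell_variance_eq:
  assumes h: "h \<in> borel_measurable lebesgue" "AE x in lebesgue. \<bar>h x\<bar> \<le> M"
    and Q: "Q \<in> dyadic_level k" and k: "k' \<le> k"
  shows "cell_variance h k' Q = energy h k' Q - (average h Q)\<^sup>2 * measure lebesgue Q"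
proof -
  define a where "a = average h Q"
  have m: "(\<Sum>P\<in>cells k' Q. measure lebesgue P) = measure lebesgue Q"
    using measure_Union_cells[OF bounded_level[OF Q] order_refl, of k'] Union_cells[OF Q k] by simp
  have "(\<Sum>P\<in>cells k' Q. average h P * measure lebesgue P) = (\<Sum>P\<in>cells k' Q. LINT x:P|lebesgue. h x)"
    by (intro sum.cong) (auto simp: cells_def average_times_measure)
  then have i: "(\<Sum>P\<in>cells k' Q. average h P * measure lebesgue P) = a * measure lebesgue Q"
    using set_integral_Union_cells[OF h bounded_level[OF Q] order_refl, of k'] Union_cells[OF Q k]
      average_times_measure[OF Q, of h] by (simp add: a_def)
  have "cell_variance h k' Q
      = (\<Sum>P\<in>cells k' Q. (average h P)\<^sup>2 * measure lebesgue P
          - 2 * a * (average h P * measure lebesgue P) + a\<^sup>2 * measure lebesgue P)"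
    unfolding cell_variance_def a_def by (intro sum.cong) (auto simp: power2_eq_square algebra_simps)
  also have "\<dots> = energy h k' Q - 2 * a * (a * measure lebesgue Q) + a\<^sup>2 * measure lebesgue Q"
    unfolding energy_def sum.distrib sum_subtractf sum_distrib_left[symmetric] m i ..
  finally show ?thesis by (simp add: a_def power2_eq_square algebra_simps)
qed

lemma cell_variance_sum:
  assumes h: "h \<in> borel_measurable lebesgue" "AE x in lebesgue. \<bar>h x\<bar> \<le> M"
    and R: "R \<in> dyadic_level k" and k: "k' \<le> k" "k'' \<le> k'"
  shows "(\<Sum>Q\<in>cells k' R. cell_variance h k'' Q) = energy h k'' R - energy h k' R"
proof -
  have "(\<Sum>Q\<in>cells k' R. cell_variance h k'' Q)
      = (\<Sum>Q\<in>cells k' R. energy h k'' Q - (average h Q)\<^sup>2 * measure lebesgue Q)"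
    using k by (intro sum.cong cell_variance_eq[OF h]) (auto simp: cells_def)
  also have "\<dots> = energy h k'' R - energy h k' R"
    using sum_cells_cells[OF R k, of "\<lambda>P. (average h P)\<^sup>2 * measure lebesgue P"]
    by (simp add: sum_subtractf energy_def)
  finally show ?thesis .
qed

lemma energy_nonneg: "0 \<le> energy h k R"
  unfolding energy_def by (intro sum_nonneg) simp

lemma energy_le:
  assumes h: "h \<in> borel_measurable lebesgue" "AE x in lebesgue. \<bar>h x\<bar> \<le> M"
    and R: "R \<in> dyadic_level k" and k: "k' \<le> k"
  shows "energy h k' R \<le> M\<^sup>2 * measure lebesgue R"
proof -
  have "energy h k' R \<le> (\<Sum>P\<in>cells k' R. M\<^sup>2 * measure lebesgue P)"
    unfolding energy_def
  proof (intro sum_mono mult_right_mono)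
    fix P assume "P \<in> cells k' R"
    then have "\<bar>average h P\<bar> \<le> M" by (intro average_bound[OF h]) (auto simp: cells_def)
    then show "(average h P)\<^sup>2 \<le> M\<^sup>2" unfolding abs_le_square_iff[symmetric] by linarith
  qed simp
  also have "\<dots> = M\<^sup>2 * measure lebesgue R"
    using measure_Union_cells[OF bounded_level[OF R] order_refl, of k'] Union_cells[OF R k]
    by (simp add: sum_distrib_left[symmetric])
  finally show ?thesis .
qed

text \<open>
  For \<open>N = 1\<close> the sum telescopes; a shift by \<open>N\<close> is composed of \<open>N\<close> unit shifts, each of which
  contributes at most \<open>B\<close>.
\<close>

lemma sum_shift_diff_le:
  fixes S :: "nat \<Rightarrow> real"
  assumes "\<And>j. 0 \<le> S j" "\<And>j. S j \<le> B"
  shows "(\<Sum>j<J. S (j + N) - S j) \<le> real N * B"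
proof (induction N)
  case (Suc N)
  have "(\<Sum>j<J. S (j + Suc N) - S j)
      = (\<Sum>j<J. S (j + N) - S j) + (\<Sum>j<J. S (Suc j + N) - S (j + N))"
    by (simp add: sum.distrib[symmetric])
  also have "(\<Sum>j<J. S (Suc j + N) - S (j + N)) = S (J + N) - S N"
    using sum_lessThan_telescope[of "\<lambda>j. S (j + N)" J] by simp
  finally show ?case using Suc assms(1)[of N] assms(2)[of "J + N"] by (simp add: algebra_simps)
qed simp

text \<open>
  The variances of the cubes of one level add up to an energy difference between two levels, and
  all energies lie between \<open>0\<close> and \<open>M\<^sup>2 * measure lebesgue R\<close>. The bound is therefore independent
  of the number \<open>J\<close> of levels, which is the source of the Carleson estimate.
\<close>

lemma cell_variance_packing:
  assumes h: "h \<in> borel_measurable lebesgue" "AE x in lebesgue. \<bar>h x\<bar> \<le> M"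
    and R: "R \<in> dyadic_level k"
  shows "(\<Sum>j<J. \<Sum>Q\<in>cells (k - int j) R. cell_variance h (k - int j - int N) Q)
           \<le> real N * (M\<^sup>2 * measure lebesgue R)"
proof -
  have "(\<Sum>j<J. \<Sum>Q\<in>cells (k - int j) R. cell_variance h (k - int j - int N) Q)
      = (\<Sum>j<J. energy h (k - int (j + N)) R - energy h (k - int j) R)"
    by (intro sum.cong refl, subst cell_variance_sum[OF h R]) (simp_all add: algebra_simps)
  also have "\<dots> \<le> real N * (M\<^sup>2 * measure lebesgue R)"
    by (rule sum_shift_diff_le[of "\<lambda>j. energy h (k - int j) R"])
      (auto intro: energy_nonneg energy_le[OF h R])
  finally show ?thesis .
qed

section \<open>Bad cubes have large variance\<close>

lemma cube_map_image:
  fixes Q :: "(real ^ 'n) set"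
  assumes Q: "Q \<in> dyadic_level k"
  shows "inj (cube_map Q)"
    and "measure lebesgue (cube_map Q ` S) = measure lebesgue Q * measure lebesgue S"
    and "S \<in> lmeasurable \<Longrightarrow> cube_map Q ` S \<in> lmeasurable"
proof -
  have s: "side_length Q = 2 powi k" by (rule side_length_level[OF Q])
  have eq: "cube_map Q = (\<lambda>x. 2 powi k *\<^sub>R x + corner Q)"
    by (auto simp: cube_map_def s add.commute)
  show "inj (cube_map Q)" by (auto simp: inj_def eq)
  show "measure lebesgue (cube_map Q ` S) = measure lebesgue Q * measure lebesgue S"
    unfolding eq measure_lebesgue_affine level_measure(2)[OF Q] by simp
  assume S: "S \<in> lmeasurable"
  have "cube_map Q ` S \<in> sets lebesgue"
    using S unfolding eq by (intro differentiable_image_in_sets_lebesgue) (auto intro!: derivative_intros)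
  moreover have "emeasure lebesgue (cube_map Q ` S) < \<infinity>"
    unfolding eq emeasure_lebesgue_affine using S
    by (simp add: fmeasurable_def ennreal_mult_less_top power_less_top_ennreal del: emeasure_completion)
  ultimately show "cube_map Q ` S \<in> lmeasurable" by (auto simp: fmeasurable_def)
qed

text \<open>
  Let \<open>a\<close> be the average of \<open>h\<close> on \<open>Q\<close>. On a bad cube \<open>h - a\<close> has an integral of size more than
  \<open>\<epsilon> * c * measure lebesgue Q\<close> over the transported set, and at least half of it survives when the
  set is replaced by a union of cells, since \<open>\<bar>h - a\<bar> \<le> 2 * M\<close>. The integral over a union of cells
  involves only the averages of \<open>h\<close> on cells, so that these must deviate from \<open>a\<close>.
\<close>

lemma bad_cube_variance:
  fixes E :: "(real ^ 'n) set"
  assumes h: "h \<in> borel_measurable lebesgue" "AE x in lebesgue. \<bar>h x\<bar> \<le> M" and M: "0 < M"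
    and eps: "0 < \<epsilon>" and c: "0 < c" "c \<le> measure lebesgue E" and E: "E \<in> lmeasurable"
    and Q: "Q \<in> dyadic_level k"
    and \<C>: "\<C> \<subseteq> cells (- int N) (half_open_cube 0 1)"
    and close: "measure lebesgue (sym_diff E (\<Union>\<C>)) < \<epsilon> * c / (4 * M)"
    and bad: "\<epsilon> < \<bar>average h (cube_map Q ` E) - average h Q\<bar>"
  shows "(\<epsilon> * c / 2)\<^sup>2 * measure lebesgue Q \<le> cell_variance h (k - int N) Q"
proof -
  define T where "T = cube_map Q"
  define a where "a = average h Q"
  define b where "b = \<epsilon> * c / 2"
  define F where "F = \<Union>\<C>"
  define q where "q = measure lebesgue Q"
  define \<D> where "\<D> = (`) T ` \<C>"
  have b: "0 < b" using eps c by (simp add: b_def)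
  have q: "0 < q" using level_measure(3)[OF Q] by (simp add: q_def)
  have F: "F \<in> lmeasurable"
    unfolding F_def using \<C> bounded_level[OF half_open_unit_cube] by (intro lmeasurable_Union_cells) auto
  note T = cube_map_image[OF Q, folded T_def q_def]
  have a: "\<bar>a\<bar> \<le> M" unfolding a_def by (rule average_bound[OF h Q])
  have g: "(\<lambda>x. h x - a) \<in> borel_measurable lebesgue" "AE x in lebesgue. \<bar>h x - a\<bar> \<le> 2 * M"
  proof -
    show "(\<lambda>x. h x - a) \<in> borel_measurable lebesgue" using h(1) by simp
    show "AE x in lebesgue. \<bar>h x - a\<bar> \<le> 2 * M" using h(2) by eventually_elim (use a in linarith)
  qed
  have nu: "(LINT x:S|lebesgue. h x - a) = (LINT x:S|lebesgue. h x) - a * measure lebesgue S"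
    if "S \<in> lmeasurable" for S
  proof -
    have "set_integrable lebesgue S (\<lambda>_. a)"
      using that by (intro bounded_set_integral(1)[where B = "\<bar>a\<bar>"]) auto
    then have "(LINT x:S|lebesgue. h x - a) = (LINT x:S|lebesgue. h x) - (LINT x:S|lebesgue. a)"
      using bounded_set_integral(1)[OF h that] by (intro set_integral_diff)
    then show ?thesis using that by (simp add: set_lebesgue_integral_def fmeasurable_def)
  qed
  have TE: "T ` E \<in> lmeasurable" "measure lebesgue (T ` E) = q * measure lebesgue E" "T ` F \<in> lmeasurable"
    using T E F by auto
  have E0: "0 < measure lebesgue E" using c by linarith
  \<comment> \<open>The integral of \<open>h - a\<close> over the transported set is large.\<close>
  have "2 * b * q \<le> \<epsilon> * measure lebesgue (T ` E)"
    using c(2) eps q by (simp add: b_def TE mult.assoc mult.commute mult_left_mono)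
  also have "\<dots> < \<bar>average h (T ` E) - a\<bar> * measure lebesgue (T ` E)"
    using bad q E0 by (intro mult_strict_right_mono) (auto simp: T_def[symmetric] a_def TE)
  also have "\<dots> = \<bar>(average h (T ` E) - a) * measure lebesgue (T ` E)\<bar>" by (simp add: abs_mult)
  also have "(average h (T ` E) - a) * measure lebesgue (T ` E) = (LINT x:T ` E|lebesgue. h x - a)"
    unfolding nu[OF TE(1)] average_def using q E0 by (simp add: TE left_diff_distrib)
  finally have 1: "2 * b * q < \<bar>LINT x:T ` E|lebesgue. h x - a\<bar>" .
  \<comment> \<open>Replacing the set by the union of cells changes the integral by at most half of that.\<close>
  have "\<bar>(LINT x:T ` E|lebesgue. h x - a) - (LINT x:T ` F|lebesgue. h x - a)\<bar>
      \<le> 2 * M * measure lebesgue (sym_diff (T ` E) (T ` F))"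
    by (rule set_integral_diff_le_sym_diff[OF g TE(1,3)])
  also have "sym_diff (T ` E) (T ` F) = T ` sym_diff E F"
    by (simp add: image_Un image_set_diff[OF T(1)])
  also have "2 * M * measure lebesgue (T ` sym_diff E F) = q * (2 * M * measure lebesgue (sym_diff E F))"
    by (simp add: T(2))
  also have "\<dots> \<le> q * b"
    using close M q by (intro mult_left_mono) (auto simp: F_def b_def field_simps)
  also have "q * b = b * q" by (rule mult.commute)
  finally have 2: "b * q \<le> \<bar>LINT x:T ` F|lebesgue. h x - a\<bar>"
    using 1 by (simp only: mult.assoc)
  have \<D>: "\<D> \<subseteq> cells (k - int N) Q"
    using cube_map_level[OF Q] \<C> by (auto simp: \<D>_def T_def)
  have TF: "T ` F = \<Union>\<D>" by (auto simp: \<D>_def F_def)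
  have "(LINT x:T ` F|lebesgue. h x - a) = (\<Sum>P\<in>\<D>. LINT x:P|lebesgue. h x - a)"
    unfolding TF by (rule set_integral_Union_cells[OF g bounded_level[OF Q] \<D>])
  also have "\<bar>\<dots>\<bar> \<le> (\<Sum>P\<in>\<D>. \<bar>LINT x:P|lebesgue. h x - a\<bar>)" by (rule sum_abs)
  also have "\<dots> \<le> (\<Sum>P\<in>cells (k - int N) Q. \<bar>LINT x:P|lebesgue. h x - a\<bar>)"
    using finite_cells[OF bounded_level[OF Q]] \<D> by (intro sum_mono2) auto
  also have "\<dots> \<le> (\<Sum>P\<in>cells (k - int N) Q. b / 2 * measure lebesgue P
                     + (average h P - a)\<^sup>2 * measure lebesgue P / (2 * b))"
  proof (rule sum_mono)
    fix P assume "P \<in> cells (k - int N) Q"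
    then have P: "P \<in> dyadic_level (k - int N)" by (auto simp: cells_def)
    define t where "t = \<bar>average h P - a\<bar>"
    have "(LINT x:P|lebesgue. h x - a) = (average h P - a) * measure lebesgue P"
      unfolding nu[OF level_measure(1)[OF P]] average_times_measure[OF P, symmetric]
      by (simp add: left_diff_distrib)
    then have "\<bar>LINT x:P|lebesgue. h x - a\<bar> = t * measure lebesgue P"
      by (simp add: abs_mult t_def)
    \<comment> \<open>This inequality between means passes from the absolute deviation to its square, in place
       of Cauchy-Schwarz; summation turns \<open>b / 2\<close> into half of the lower bound just obtained.\<close>
    also have "t \<le> b / 2 + t\<^sup>2 / (2 * b)"
    proof -
      have "0 \<le> (b - t)\<^sup>2 / (2 * b)" using b by simp
      also have "\<dots> = b / 2 + t\<^sup>2 / (2 * b) - t" using b by (simp add: power2_eq_square field_simps)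
      finally show ?thesis by simp
    qed
    finally show "\<bar>LINT x:P|lebesgue. h x - a\<bar>
        \<le> b / 2 * measure lebesgue P + (average h P - a)\<^sup>2 * measure lebesgue P / (2 * b)"
      by (simp add: mult_right_mono distrib_right t_def)
  qed
  also have "\<dots> = b / 2 * q + cell_variance h (k - int N) Q / (2 * b)"
    using measure_Union_cells[OF bounded_level[OF Q] order_refl, of "k - int N"] Union_cells[OF Q, of "k - int N"]
    by (simp add: sum.distrib sum_distrib_left[symmetric] sum_divide_distrib[symmetric]
        cell_variance_def a_def q_def)
  finally have "b * q \<le> b / 2 * q + cell_variance h (k - int N) Q / (2 * b)" using 2 by linarith
  then have "b * q / 2 \<le> cell_variance h (k - int N) Q / (2 * b)" by simp
  then have "b * q / 2 * (2 * b) \<le> cell_variance h (k - int N) Q"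
    using b by (subst (asm) pos_le_divide_eq) auto
  then show ?thesis by (simp add: b_def[symmetric] q_def[symmetric] power2_eq_square mult_ac)
qed

section \<open>The Carleson packing condition\<close>

theorem corollary5p12:
  fixes L \<epsilon> M :: real
    and \<E> :: "real \<Rightarrow> (real ^ 'n) set set"
  assumes "L \<ge> 1" and "\<epsilon> > 0" and "M > 0"
    and "sandwichable (\<E> L)"
  shows "\<exists>C>0. \<forall>h :: real ^ 'n \<Rightarrow> real.
           h \<in> borel_measurable lebesgue \<longrightarrow> Linfty_norm h \<le> ereal M \<longrightarrow>
           carleson C (dyadic_cubes - good_cubes \<epsilon> (\<E> L) h)"
proof -
  have meas: "E \<in> sets lebesgue" "E \<subseteq> cbox 0 1" if "E \<in> \<E> L" for E
    using that assms(4)[unfolded sandwichable_def, THEN conjunct1] by blast+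
  obtain c where c: "0 < c" "\<And>E. E \<in> \<E> L \<Longrightarrow> c \<le> measure lebesgue E"
    using assms(4)[unfolded sandwichable_def, THEN conjunct2, THEN conjunct1] by blast
  have "0 < \<epsilon> * c / (4 * M)" using assms c by simp
  from sandwichable_uniform_approximation[OF assms(4) this]
  obtain N where N: "\<And>E. E \<in> \<E> L \<Longrightarrow> \<exists>\<C> \<subseteq> cells (- int N) (half_open_cube 0 1).
      measure lebesgue (sym_diff E (\<Union>\<C>)) < \<epsilon> * c / (4 * M)" by blast
  define b where "b = (\<epsilon> * c / 2)\<^sup>2"
  have b: "0 < b" using assms c by (simp add: b_def)
  \<comment> \<open>The summand \<open>1\<close> keeps the constant positive when \<open>N = 0\<close>.\<close>
  define C where "C = (real N + 1) * M\<^sup>2 / b"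
  have C: "0 < C" using b assms(3) by (simp add: C_def)
  show ?thesis
  proof (intro exI[of _ C] conjI allI impI C)
    fix h :: "real ^ 'n \<Rightarrow> real"
    assume h1: "h \<in> borel_measurable lebesgue" and "Linfty_norm h \<le> ereal M"
    then have h2: "AE x in lebesgue. \<bar>h x\<bar> \<le> M" by (intro Linfty_norm_AE)
    define \<B> where "\<B> = dyadic_cubes - good_cubes \<epsilon> (\<E> L) h"
    have bad: "b * measure lebesgue Q \<le> cell_variance h (k - int N) Q"
      if Q: "Q \<in> \<B>" "Q \<in> dyadic_level k" for Q k
    proof -
      obtain E where E: "E \<in> \<E> L" "\<epsilon> < \<bar>average h (cube_map Q ` E) - average h Q\<bar>"
        using Q by (auto simp: \<B>_def good_cubes_def transported_family_def not_le)
      obtain \<C> where \<C>: "\<C> \<subseteq> cells (- int N) (half_open_cube 0 1)"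
          "measure lebesgue (sym_diff E (\<Union>\<C>)) < \<epsilon> * c / (4 * M)"
        using N[OF E(1)] by blast
      have "E \<in> lmeasurable"
        by (rule bounded_set_imp_lmeasurable[OF bounded_subset[OF bounded_cbox meas(2)[OF E(1)]] meas(1)[OF E(1)]])
      then show ?thesis
        unfolding b_def
        by (rule bad_cube_variance[OF h1 h2 assms(3,2) c(1) c(2)[OF E(1)] _ Q(2) \<C> E(2)])
    qed
    show "carleson C (dyadic_cubes - good_cubes \<epsilon> (\<E> L) h)"
      unfolding carleson_def \<B>_def[symmetric]
    proof (intro ballI infsum_le_finite_sums)
      fix R \<F>
      assume "R \<in> (dyadic_cubes :: (real ^ 'n) set set)" and fin: "finite \<F>" and \<F>: "\<F> \<subseteq> {Q \<in> \<B>. Q \<subseteq> R}"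
      then obtain k where R: "R \<in> dyadic_level k" by (auto simp: dyadic_cubes_eq_levels)
      have "\<exists>j. Q \<in> cells (k - int j) R" if "Q \<in> \<F>" for Q
      proof -
        have QR: "Q \<subseteq> R" and "Q \<in> dyadic_cubes" using that \<F> by (auto simp: \<B>_def)
        then obtain k' where Q: "Q \<in> dyadic_level k'" by (auto simp: dyadic_cubes_eq_levels)
        obtain m where Qm: "Q = half_open_cube m (2 powi k')" using Q by (auto elim: dyadic_levelE)
        obtain m' where Rm: "R = half_open_cube m' (2 powi k)" using R by (auto elim: dyadic_levelE)
        have "(2::real) powi k' \<le> 2 powi k"
          using half_open_cube_subset[OF QR[unfolded Qm Rm]] by fastforce
        then have "k' \<le> k"
          using power_int_strict_increasing[of k k' "2 :: real"] by (auto simp: not_less[symmetric])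
        then have "Q \<in> cells (k - int (nat (k - k'))) R" using Q QR by (simp add: cells_def)
        then show ?thesis by blast
      qed
      then obtain j where j: "\<And>Q. Q \<in> \<F> \<Longrightarrow> Q \<in> cells (k - int (j Q)) R" by metis
      define J where "J = Suc (Max (insert 0 (j ` \<F>)))"
      have J: "j Q < J" if "Q \<in> \<F>" for Q
        using that fin by (simp add: J_def less_Suc_eq_le)
      let ?D = "\<lambda>i. cells (k - int i) R"
      have finD: "finite (?D i)" for i using finite_cells[OF bounded_level[OF R]] .
      \<comment> \<open>Bad cubes have large variance, and finitely many of them lie in finitely many generations
         below \<open>R\<close>.\<close>
      have "b * (\<Sum>Q\<in>\<F>. measure lebesgue Q) = (\<Sum>Q\<in>\<F>. b * measure lebesgue Q)"
        by (rule sum_distrib_left)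
      also have "\<dots> \<le> (\<Sum>Q\<in>\<F>. cell_variance h (k - int (j Q) - int N) Q)"
        using j \<F> by (intro sum_mono bad) (auto simp: cells_def)
      also have "\<dots> = (\<Sum>(i, Q)\<in>(\<lambda>Q. (j Q, Q)) ` \<F>. cell_variance h (k - int i - int N) Q)"
        by (subst sum.reindex) (auto simp: inj_on_def)
      also have "\<dots> \<le> (\<Sum>(i, Q)\<in>Sigma {..<J} ?D. cell_variance h (k - int i - int N) Q)"
        using j J finD by (intro sum_mono2) (auto intro: cell_variance_nonneg)
      also have "\<dots> = (\<Sum>i<J. \<Sum>Q\<in>?D i. cell_variance h (k - int i - int N) Q)"
        using finD by (subst sum.Sigma) auto
      also have "\<dots> \<le> real N * (M\<^sup>2 * measure lebesgue R)"
        by (rule cell_variance_packing[OF h1 h2 R])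
      also have "\<dots> \<le> (real N + 1) * (M\<^sup>2 * measure lebesgue R)"
        by (intro mult_right_mono) auto
      also have "\<dots> = b * (C * measure lebesgue R)" using b by (simp add: C_def)
      finally have main: "(\<Sum>Q\<in>\<F>. measure lebesgue Q) \<le> C * measure lebesgue R" using b by simp
      have vol: "measure lebesgue Q = side_length Q ^ CARD('n)" if "Q \<in> dyadic_cubes" for Q :: "(real ^ 'n) set"
        using that by (auto simp: dyadic_cubes_eq_levels level_measure side_length_level)
      have Rd: "R \<in> dyadic_cubes" using R by (auto simp: dyadic_cubes_eq_levels)
      have "(\<Sum>Q\<in>\<F>. ennreal (side_length Q ^ CARD('n))) = (\<Sum>Q\<in>\<F>. ennreal (measure lebesgue Q))"
        using \<F> by (intro sum.cong) (auto simp: vol \<B>_def)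
      also have "\<dots> = ennreal (\<Sum>Q\<in>\<F>. measure lebesgue Q)" by simp
      also have "\<dots> \<le> ennreal (C * side_length R ^ CARD('n))"
        unfolding vol[OF Rd, symmetric] using main by (rule ennreal_leI)
      finally show "(\<Sum>Q\<in>\<F>. ennreal (side_length Q ^ CARD('n))) \<le> ennreal (C * side_length R ^ CARD('n))" .
    qed (simp add: nonneg_summable_on_complete)
  qed
qed

end
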